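(* In the polynomial ring $\mathbb{R}[X,Y]$ let $f_1=Y^3$, $f_2=Y+X$, $f_3=1-XY$, $f_4=1-X^2$. Then the preordering $P=\mathrm{PO}(f_1,\ldots,f_4)$ does not have the $\ddagger$-property, i.e. $P^{\ddagger}\neq\mathrm{Pos}(\mathcal{S}(P))$.
   Context: For $f_1,\ldots,f_s\in\mathbb{R}[X,Y]$, $\mathrm{PO}(f_1,\ldots,f_s)=\{\sum_{e\in\{0,1\}^s}\sigma_e f_1^{e_1}\cdots f_s^{e_s}\mid \sigma_e \text{ a sum of squares in } \mathbb{R}[X,Y]\}$ is the preordering generated by $f_1,\ldots,f_s$. For $P=\mathrm{PO}(f_1,\ldots,f_s)$, $\mathcal{S}(P)=\{x\in\mathbb{R}^2\mid f_1(x)\ge 0,\ldots,f_s(x)\ge 0\}$, and for a set $Z\subseteq\mathbb{R}^2$, $\mathrm{Pos}(Z)$ is the set of polynomials in $\mathbb{R}[X,Y]$ that are nonnegative on $Z$. Moreover $P^{\ddagger}=\{f\in\mathbb{R}[X,Y]\mid \exists q\in\mathbb{R}[X,Y]\ \forall \varepsilon>0:\ f+\varepsilon q\in P\}$ (the sequential closure of $P$ in the finest locally convex topology on $\mathbb{R}[X,Y]$). $P$ has the $\ddagger$-property if $P^{\ddagger}=\mathrm{Pos}(\mathcal{S}(P))$. *)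

theory Defs
  imports Complex_Main "HOL-Computational_Algebra.Polynomial" "HOL-Library.FuncSet"
begin

text \<open>
  The ring \<open>\<real>[X,Y]\<close> is represented as \<open>\<real>[X][Y]\<close>: the outer variable is \<open>Y\<close>, the
  coefficients are polynomials in \<open>X\<close>. Real constants \<open>c\<close> are embedded as \<open>[:[:c:]:]\<close>.
\<close>

type_synonym poly_XY = "real poly poly"

definition var_X :: poly_XY where
  "var_X = [:[:0, 1:]:]"

definition var_Y :: poly_XY where
  "var_Y = [:0, 1:]"

definition eval_XY :: "poly_XY \<Rightarrow> real \<times> real \<Rightarrow> real" where
  "eval_XY f z = poly (poly f [:snd z:]) (fst z)"

lemma eval_XY_simps [simp]:
  "eval_XY 0 z = 0" "eval_XY 1 z = 1"
  "eval_XY var_X z = fst z" "eval_XY var_Y z = snd z" "eval_XY [:[:c:]:] z = c"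
  "eval_XY (f + g) z = eval_XY f z + eval_XY g z"
  "eval_XY (f - g) z = eval_XY f z - eval_XY g z"
  "eval_XY (f * g) z = eval_XY f z * eval_XY g z"
  "eval_XY (f ^ n) z = eval_XY f z ^ n"
  by (simp_all add: eval_XY_def var_X_def var_Y_def)

definition sum_of_squares :: "poly_XY \<Rightarrow> bool" where
  "sum_of_squares \<sigma> \<longleftrightarrow> (\<exists>gs. \<sigma> = (\<Sum>g\<leftarrow>gs. g ^ 2))"

text \<open>Below, a list \<open>fs\<close> of length \<open>s\<close> is the tuple of generators \<open>f\<^sub>1, \<dots>, f\<^sub>s\<close>.\<close>

definition PO :: "poly_XY list \<Rightarrow> poly_XY set" where
  "PO fs = {(\<Sum>e \<in> {..<length fs} \<rightarrow>\<^sub>E {0, 1 :: nat}. \<sigma> e * (\<Prod>i<length fs. (fs ! i) ^ e i)) | \<sigma>.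
     \<forall>e \<in> {..<length fs} \<rightarrow>\<^sub>E {0, 1}. sum_of_squares (\<sigma> e)}"

definition nonneg_set :: "poly_XY list \<Rightarrow> (real \<times> real) set" where
  "nonneg_set fs = {z. \<forall>f \<in> set fs. eval_XY f z \<ge> 0}"

definition Pos :: "(real \<times> real) set \<Rightarrow> poly_XY set" where
  "Pos Z = {f. \<forall>z \<in> Z. eval_XY f z \<ge> 0}"

definition ddagger :: "poly_XY set \<Rightarrow> poly_XY set" where
  "ddagger P = {f. \<exists>q. \<forall>\<epsilon>::real. \<epsilon> > 0 \<longrightarrow> f + [:[:\<epsilon>:]:] * q \<in> P}"

text \<open>
  The property belongs to the preordering \<open>P = PO fs\<close>, and \<open>\<S>(P)\<close> is given through the
  generators; lemma \<open>nonneg_set_eq\<close> below shows that \<open>\<S>(P)\<close> depends only on \<open>P\<close>.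
\<close>

definition ddagger_property :: "poly_XY list \<Rightarrow> bool" where
  "ddagger_property fs \<longleftrightarrow> ddagger (PO fs) = Pos (nonneg_set fs)"

lemma eval_XY_sum: "eval_XY (sum f A) z = (\<Sum>a\<in>A. eval_XY (f a) z)"
  by (simp add: eval_XY_def poly_sum)

lemma eval_XY_prod: "eval_XY (prod f A) z = (\<Prod>a\<in>A. eval_XY (f a) z)"
  by (simp add: eval_XY_def poly_prod)

lemma sum_of_squares_nonneg: "sum_of_squares \<sigma> \<Longrightarrow> eval_XY \<sigma> z \<ge> 0"
proof -
  have "eval_XY (\<Sum>g\<leftarrow>gs. g ^ 2) z \<ge> 0" for gs
    by (induction gs) auto
  then show "sum_of_squares \<sigma> \<Longrightarrow> eval_XY \<sigma> z \<ge> 0"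
    by (auto simp: sum_of_squares_def)
qed

lemma generator_in_PO:
  assumes "f \<in> set fs"
  shows "f \<in> PO fs"
proof -
  obtain k where k: "k < length fs" "f = fs ! k"
    using assms by (auto simp: in_set_conv_nth)
  let ?E = "{..<length fs} \<rightarrow>\<^sub>E {0, 1 :: nat}"
  define d :: "nat \<Rightarrow> nat" where
    "d = restrict (\<lambda>i. if i = k then 1 else 0) {..<length fs}"
  define \<sigma> :: "(nat \<Rightarrow> nat) \<Rightarrow> poly_XY" where "\<sigma> = (\<lambda>e. if e = d then 1 else 0)"
  have d: "d \<in> ?E" by (auto simp: d_def)
  have fin: "finite ?E" by (intro finite_PiE) auto
  have "(\<Prod>i<length fs. (fs ! i) ^ d i) = (\<Prod>i<length fs. if i = k then fs ! i else 1)"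
    by (intro prod.cong) (auto simp: d_def)
  also have "\<dots> = f"
    using k by (simp add: prod.delta)
  finally have p: "(\<Prod>i<length fs. (fs ! i) ^ d i) = f" .
  have "(\<Sum>e\<in>?E. \<sigma> e * (\<Prod>i<length fs. (fs ! i) ^ e i))
      = (\<Sum>e\<in>?E. if e = d then f else 0)"
    using p by (intro sum.cong) (auto simp: \<sigma>_def)
  also have "\<dots> = f"
    using d fin by (simp add: sum.delta)
  finally have s: "f = (\<Sum>e\<in>?E. \<sigma> e * (\<Prod>i<length fs. (fs ! i) ^ e i))" ..
  have "sum_of_squares 1"
    unfolding sum_of_squares_def by (rule exI[of _ "[1]"]) simp
  moreover have "sum_of_squares 0"
    unfolding sum_of_squares_def by (rule exI[of _ "[]"]) simp
  ultimately have "\<forall>e\<in>?E. sum_of_squares (\<sigma> e)"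
    by (simp add: \<sigma>_def)
  with s show ?thesis
    unfolding PO_def by blast
qed

lemma nonneg_set_eq: "nonneg_set fs = {z. \<forall>p \<in> PO fs. eval_XY p z \<ge> 0}"
proof
  show "{z. \<forall>p \<in> PO fs. eval_XY p z \<ge> 0} \<subseteq> nonneg_set fs"
    using generator_in_PO by (auto simp: nonneg_set_def)
  show "nonneg_set fs \<subseteq> {z. \<forall>p \<in> PO fs. eval_XY p z \<ge> 0}"
  proof (intro subsetI CollectI ballI)
    fix z p
    assume z: "z \<in> nonneg_set fs" and "p \<in> PO fs"
    then obtain \<sigma> where
      p: "p = (\<Sum>e \<in> {..<length fs} \<rightarrow>\<^sub>E {0, 1 :: nat}. \<sigma> e * (\<Prod>i<length fs. (fs ! i) ^ e i))"
      and \<sigma>: "\<forall>e \<in> {..<length fs} \<rightarrow>\<^sub>E {0, 1}. sum_of_squares (\<sigma> e)"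
      unfolding PO_def by blast
    have f: "eval_XY (fs ! i) z \<ge> 0" if "i < length fs" for i
      using z that by (simp add: nonneg_set_def)
    show "eval_XY p z \<ge> 0"
      unfolding p eval_XY_sum eval_XY_simps eval_XY_prod
      using f \<sigma> sum_of_squares_nonneg
      by (intro sum_nonneg mult_nonneg_nonneg prod_nonneg zero_le_power) auto
  qed
qed

end

theory Submission
  imports Defs
begin

text \<open>
  The polynomial \<open>Y\<close> is nonnegative on \<open>\<S>(P)\<close> because \<open>Y\<^sup>3\<close> is, but it does not lie in
  \<open>P\<^sup>\<ddagger>\<close>. Suppose that \<open>Y + \<epsilon> q \<in> P\<close> for all \<open>\<epsilon> > 0\<close>, and collect the terms that
  contain the generator \<open>Y\<^sup>3\<close>: this gives \<open>Y + \<epsilon> q = A + Y\<^sup>3 B\<close>, where \<open>A\<close> and \<open>B\<close>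
  depend on \<open>\<epsilon>\<close> and are nonnegative wherever \<open>Y + X\<close>, \<open>1 - X Y\<close> and \<open>1 - X\<^sup>2\<close> are
  (lemma \<open>PO_Cons_decompose\<close>). Vertical lines on the two sides
  of the \<open>Y\<close>-axis now impose conflicting conditions on \<open>A\<close>.

  On the lines \<open>X = x\<close> with \<open>-1 < x < 0\<close> the set \<open>\<S>(P)\<close> contains a half-line, where
  \<open>0 \<le> A \<le> Y + \<epsilon> q\<close>. Hence nothing of high degree can cancel, and the degree of \<open>A\<close> in
  \<open>Y\<close> is at most \<open>max 1 d\<close>, where \<open>d\<close> is the degree of \<open>q\<close> in \<open>Y\<close>. There
  are infinitely many such lines, so this bound, which is independent of \<open>\<epsilon>\<close>, holds for \<open>A\<close> as a polynomial in two variables (lemma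
  \<open>degree_le_of_half_lines\<close>).

  On the line \<open>X = 1/2\<close> the inequality \<open>0 \<le> A \<le> Y + \<epsilon> q\<close> holds for \<open>0 \<le> Y \<le> 1\<close>. As
  the degree is bounded, interpolation (lemma \<open>coeff_bound_by_values\<close>) bounds all coefficients
  of \<open>A\<close> uniformly in \<open>\<epsilon>\<close>. The factor \<open>Y\<^sup>3\<close> leaves the two lowest coefficients alone,
  so \<open>A = \<epsilon> q\<^sub>0 + (1 + \<epsilon> q\<^sub>1) Y + O(Y\<^sup>2)\<close>, with a uniform constant. But \<open>A\<close> is also
  nonnegative for slightly negative \<open>Y\<close>, since only \<open>Y\<^sup>3\<close> excludes these points from
  \<open>\<S>(P)\<close>; as \<open>\<epsilon>\<close> tends to \<open>0\<close>, this contradicts the linear term (lemma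
  \<open>no_uniformly_bounded_perturbation\<close>).
\<close>

section \<open>Splitting off one generator of a preordering\<close>

text \<open>
  \<open>A\<close> collects the terms with \<open>e\<^sub>0 = 0\<close> and \<open>B\<close> the cofactors of \<open>f\<close> in the others. No
  copy of \<open>f\<close> is left in either, which is why both stay nonnegative also where \<open>f\<close> is negative.
\<close>
lemma PO_Cons_decompose:
  assumes "p \<in> PO (f # fs)"
  obtains A B where "p = A + f * B"
    and "\<And>z. z \<in> nonneg_set fs \<Longrightarrow> eval_XY A z \<ge> 0"
    and "\<And>z. z \<in> nonneg_set fs \<Longrightarrow> eval_XY B z \<ge> 0"
proof -
  define E where "E = {..<length (f # fs)} \<rightarrow>\<^sub>E {0, 1 :: nat}"
  obtain \<sigma> where p: "p = (\<Sum>e\<in>E. \<sigma> e * (\<Prod>i<length (f # fs). ((f # fs) ! i) ^ e i))"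
    and sos: "\<forall>e\<in>E. sum_of_squares (\<sigma> e)"
    using assms unfolding PO_def E_def by blast
  define T where "T = (\<lambda>e :: nat \<Rightarrow> nat. \<sigma> e * (\<Prod>i<length fs. (fs ! i) ^ e (Suc i)))"
  have fin: "finite E"
    unfolding E_def by (intro finite_PiE) auto
  have E01: "e 0 = 0 \<or> e 0 = 1" if "e \<in> E" for e
    using that by (auto simp: E_def PiE_def Pi_def)
  have nonneg: "eval_XY (\<Sum>e\<in>{e\<in>E. e 0 = k}. T e) z \<ge> 0" if "z \<in> nonneg_set fs" for z k
    unfolding eval_XY_sum
  proof (rule sum_nonneg)
    fix e assume "e \<in> {e\<in>E. e 0 = k}"
    then have "eval_XY (\<sigma> e) z \<ge> 0"
      using sos sum_of_squares_nonneg by blast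
    then show "eval_XY (T e) z \<ge> 0"
      using that unfolding T_def eval_XY_simps eval_XY_prod
      by (intro mult_nonneg_nonneg prod_nonneg zero_le_power) (auto simp: nonneg_set_def)
  qed
  have "p = (\<Sum>e\<in>E. f ^ e 0 * T e)"
    unfolding p T_def
    by (intro sum.cong refl)
      (simp add: prod.lessThan_Suc_shift mult_ac del: prod.lessThan_Suc)
  also have "\<dots> = (\<Sum>e\<in>E. (if e 0 = 0 then T e else 0) + f * (if e 0 = 1 then T e else 0))"
    using E01 by (intro sum.cong) force+
  also have "\<dots> = (\<Sum>e\<in>{e\<in>E. e 0 = 0}. T e) + f * (\<Sum>e\<in>{e\<in>E. e 0 = 1}. T e)"
    by (simp only: sum.distrib sum_distrib_left[symmetric] sum.inter_filter[OF fin])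
  finally show thesis
    using nonneg that by blast
qed

section \<open>Restriction to a vertical line\<close>

definition restrict_X :: "real \<Rightarrow> poly_XY \<Rightarrow> real poly" where
  "restrict_X x f = map_poly (\<lambda>c. poly c x) f"

lemma coeff_restrict_X [simp]: "coeff (restrict_X x f) k = poly (coeff f k) x"
  by (simp add: restrict_X_def coeff_map_poly)

lemma poly_restrict_X: "poly (restrict_X x f) y = eval_XY f (x, y)"
  by (induction f) (simp_all add: restrict_X_def eval_XY_def map_poly_pCons)

lemma degree_restrict_X_le: "degree (restrict_X x f) \<le> degree f"
  by (rule degree_le) (simp add: coeff_eq_0)

section \<open>Degree bounds from half-lines\<close>

lemma degree_le_of_nonneg_le:
  fixes a p :: "real poly"
  assumes "\<And>y. y \<ge> c \<Longrightarrow> 0 \<le> poly a y" and "\<And>y. y \<ge> c \<Longrightarrow> poly a y \<le> poly p y"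
  shows "degree a \<le> degree p"
proof (rule ccontr)
  assume less: "\<not> degree a \<le> degree p"
  have pos: "\<exists>y\<ge>c. poly r y > 0" if "lead_coeff r > 0" for r :: "real poly"
  proof -
    obtain n where "\<forall>x\<ge>n. poly r x \<ge> lead_coeff r"
      using poly_pinfty_gt_lc \<open>lead_coeff r > 0\<close> by blast
    then have "poly r (max n c) \<ge> lead_coeff r" by simp
    with that show ?thesis by (intro exI[of _ "max n c"]) auto
  qed
  have "a \<noteq> 0" using less by auto
  then consider "lead_coeff a > 0" | "lead_coeff (- a) > 0"
    by (metis lead_coeff_minus leading_coeff_0_iff linorder_neqE_linordered_idom neg_0_less_iff_less)
  then show False
  proof cases
    case 1
    have "degree (a - p) = degree a"
      using less by (simp add: degree_add_eq_left[of "- p" a, simplified])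
    then have "lead_coeff (a - p) > 0"
      using 1 less by (simp add: coeff_eq_0)
    then show False using pos assms(2) by fastforce
  next
    case 2
    then show False using pos assms(1) by fastforce
  qed
qed

text \<open>
  On each line \<open>X = x\<close> with \<open>x \<in> L\<close> the growth of \<open>A\<close> is bounded by that of \<open>p\<close>. A coefficient
  of \<open>A\<close> with index above \<open>degree p\<close> is therefore a polynomial in \<open>X\<close> that vanishes on all of
  \<open>L\<close>, and only the zero polynomial has infinitely many roots.
\<close>
lemma degree_le_of_half_lines:
  assumes "infinite L"
    and "\<And>x y. x \<in> L \<Longrightarrow> y \<ge> c \<Longrightarrow> 0 \<le> eval_XY A (x, y)"
    and "\<And>x y. x \<in> L \<Longrightarrow> y \<ge> c \<Longrightarrow> eval_XY A (x, y) \<le> eval_XY p (x, y)"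
  shows "degree A \<le> degree p"
proof (rule degree_le, intro allI impI)
  fix k assume k: "degree p < k"
  have "poly (coeff A k) x = 0" if "x \<in> L" for x
  proof -
    have "degree (restrict_X x A) \<le> degree (restrict_X x p)"
      by (rule degree_le_of_nonneg_le[of c]) (use assms(2,3) that in \<open>auto simp: poly_restrict_X\<close>)
    then have "degree (restrict_X x A) < k"
      using k degree_restrict_X_le[of x p] by linarith
    then show ?thesis
      using coeff_eq_0 by fastforce
  qed
  then have "L \<subseteq> {x. poly (coeff A k) x = 0}" by blast
  then show "coeff A k = 0"
    using assms(1) poly_roots_finite finite_subset by blast
qed

section \<open>Coefficient bounds from interpolation\<close>

text \<open>
  Newton interpolation: splitting off a node \<open>a\<close> as \<open>p = p(a) + (X - a) r\<close> lowers the degree by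
  one, and the values of \<open>r\<close> at the other nodes are divided differences of \<open>p\<close>. The alternative
  \<open>p = 0\<close> lets the induction start with no nodes at all.
\<close>
lemma coeff_bound_by_values:
  fixes S :: "real set"
  assumes "finite S"
  shows "\<exists>K. \<forall>p M. (p = 0 \<or> degree p < card S) \<longrightarrow> 0 \<le> M \<longrightarrow>
    (\<forall>x\<in>S. \<bar>poly p x\<bar> \<le> M) \<longrightarrow> (\<forall>i. \<bar>coeff p i\<bar> \<le> K * M)"
  using assms
proof induction
  case empty
  show ?case by (intro exI[of _ 0]) auto
next
  case (insert a S)
  from insert.IH obtain K where K: "\<forall>p M. (p = 0 \<or> degree p < card S) \<longrightarrow> 0 \<le> M \<longrightarrow>
    (\<forall>x\<in>S. \<bar>poly p x\<bar> \<le> M) \<longrightarrow> (\<forall>i. \<bar>coeff p i\<bar> \<le> K * M)" ..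
  \<comment> \<open>A bound for all the factors \<open>1 / \<bar>x - a\<bar>\<close> in the divided differences.\<close>
  define c where "c = (\<Sum>x\<in>S. 1 / \<bar>x - a\<bar>)"
  have c0: "c \<ge> 0" unfolding c_def by (intro sum_nonneg) auto
  have c: "1 \<le> c * \<bar>x - a\<bar>" if "x \<in> S" for x
  proof -
    have "1 / \<bar>x - a\<bar> \<le> c"
      unfolding c_def using insert that by (intro member_le_sum) auto
    moreover have "\<bar>x - a\<bar> > 0" using insert that by auto
    ultimately show ?thesis by (simp add: field_simps)
  qed
  show ?case
  proof (intro exI[of _ "1 + (1 + \<bar>a\<bar>) * (K * (2 * c))"] allI impI)
    fix p :: "real poly" and M i
    assume deg: "p = 0 \<or> degree p < card (insert a S)" and "0 \<le> M"
      and M: "\<forall>x\<in>insert a S. \<bar>poly p x\<bar> \<le> M"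
    define r where "r = synthetic_div p a"
    have p: "p = [:- a, 1:] * r + [:poly p a:]"
      unfolding r_def by (rule synthetic_div_correct'[symmetric])
    have "r = 0 \<or> degree r < card S"
      using deg insert by (auto simp: r_def degree_synthetic_div synthetic_div_eq_0_iff)
    moreover have "\<bar>poly r x\<bar> \<le> 2 * c * M" if "x \<in> S" for x
    proof -
      have "poly p x = poly ([:- a, 1:] * r + [:poly p a:]) x"
        using p by simp
      then have "(x - a) * poly r x = poly p x - poly p a"
        by (simp add: algebra_simps)
      then have "\<bar>x - a\<bar> * \<bar>poly r x\<bar> = \<bar>poly p x - poly p a\<bar>"
        by (metis abs_mult)
      also have "\<dots> \<le> 2 * M"
        using M that by (smt (verit) insertCI)
      finally have "c * (\<bar>x - a\<bar> * \<bar>poly r x\<bar>) \<le> c * (2 * M)"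
        by (rule mult_left_mono[OF _ c0])
      moreover have "1 * \<bar>poly r x\<bar> \<le> (c * \<bar>x - a\<bar>) * \<bar>poly r x\<bar>"
        by (rule mult_right_mono[OF c[OF that]]) simp
      ultimately show ?thesis by (simp add: mult_ac)
    qed
    moreover have "0 \<le> 2 * c * M" using c0 \<open>0 \<le> M\<close> by simp
    ultimately have r: "\<bar>coeff r j\<bar> \<le> K * (2 * c * M)" for j
      using K by blast
    define N where "N = K * (2 * c * M)"
    have N0: "0 \<le> N" using r[of 0] unfolding N_def by linarith
    have ar: "\<bar>a * coeff r j\<bar> \<le> \<bar>a\<bar> * N" for j
      using r[of j] by (simp add: abs_mult N_def mult_left_mono)
    have "coeff p i = coeff ([:- a, 1:] * r + [:poly p a:]) i"
      using p by simp
    then have "\<bar>coeff p i\<bar> \<le> M + N + \<bar>a\<bar> * N"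
      using ar[of i] r[of "i - 1"] M \<open>0 \<le> M\<close> N0
      by (cases i) (auto simp: N_def[symmetric])
    also have "\<dots> = (1 + (1 + \<bar>a\<bar>) * (K * (2 * c))) * M"
      by (simp add: N_def algebra_simps)
    finally show "\<bar>coeff p i\<bar> \<le> (1 + (1 + \<bar>a\<bar>) * (K * (2 * c))) * M" .
  qed
qed

lemma abs_poly_le_sum_abs_coeff:
  fixes p :: "real poly"
  assumes "degree p \<le> n" and "\<bar>x\<bar> \<le> 1"
  shows "\<bar>poly p x\<bar> \<le> (\<Sum>i\<le>n. \<bar>coeff p i\<bar>)"
proof -
  have "poly p x = (\<Sum>i\<le>n. coeff p i * x ^ i)"
    unfolding poly_altdef using assms(1)
    by (intro sum.mono_neutral_left) (auto simp: coeff_eq_0)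
  also have "\<bar>\<dots>\<bar> \<le> (\<Sum>i\<le>n. \<bar>coeff p i\<bar>)"
    using assms(2)
    by (intro order.trans[OF sum_abs] sum_mono)
      (simp add: abs_mult power_abs mult_left_le power_le_one)
  finally show ?thesis .
qed

lemma quadratic_taylor_bound:
  fixes p :: "real poly"
  assumes "degree p \<le> n" and "\<And>i. \<bar>coeff p i\<bar> \<le> C" and "\<bar>x\<bar> \<le> 1"
  shows "poly p x \<le> coeff p 0 + coeff p 1 * x + (real n + 1) * C * x\<^sup>2"
proof -
  define r where "r = poly_shift 2 p"
  have "p = [:coeff p 0, coeff p 1:] + monom 1 2 * r"
    by (rule poly_eqI)
      (auto simp: r_def coeff_poly_shift coeff_monom_mult coeff_pCons numeral_2_eq_2 split: nat.split)
  then have "poly p x = poly ([:coeff p 0, coeff p 1:] + monom 1 2 * r) x"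
    by simp
  then have px: "poly p x = coeff p 0 + coeff p 1 * x + poly r x * x\<^sup>2"
    by (simp add: poly_monom algebra_simps)
  have "degree r \<le> n"
    using assms(1) by (intro degree_le) (auto simp: r_def coeff_poly_shift coeff_eq_0)
  then have "\<bar>poly r x\<bar> \<le> (\<Sum>i\<le>n. \<bar>coeff r i\<bar>)"
    using assms(3) by (rule abs_poly_le_sum_abs_coeff)
  also have "\<dots> \<le> (\<Sum>i\<le>n. C)"
    using assms(2) by (intro sum_mono) (simp add: r_def coeff_poly_shift)
  finally have "poly r x \<le> (real n + 1) * C"
    by (simp add: add.commute)
  then show ?thesis
    unfolding px by (simp add: mult_right_mono)
qed

section \<open>The perturbation argument\<close>

text \<open>
  A limit of the polynomials \<open>a \<epsilon>\<close> would have the form \<open>Y + O(Y\<^sup>2)\<close> and would be negative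
  at small negative points. The bounds on degree and on values make the \<open>O\<close>-term uniform, so that
  one point \<open>- s\<close> serves all small \<open>\<epsilon>\<close> and no limit has to be formed.
\<close>
lemma no_uniformly_bounded_perturbation:
  fixes a :: "real \<Rightarrow> real poly"
  assumes deg: "\<And>\<epsilon>. 0 < \<epsilon> \<Longrightarrow> \<epsilon> \<le> 1 \<Longrightarrow> degree (a \<epsilon>) \<le> n"
    and bound: "\<And>\<epsilon> y. 0 < \<epsilon> \<Longrightarrow> \<epsilon> \<le> 1 \<Longrightarrow> 0 \<le> y \<Longrightarrow> y \<le> 1 \<Longrightarrow> \<bar>poly (a \<epsilon>) y\<bar> \<le> M"
    and nonneg: "\<And>\<epsilon> y. 0 < \<epsilon> \<Longrightarrow> \<epsilon> \<le> 1 \<Longrightarrow> - \<delta> \<le> y \<Longrightarrow> y \<le> 0 \<Longrightarrow> 0 \<le> poly (a \<epsilon>) y"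
    and coeff0: "\<And>\<epsilon>. 0 < \<epsilon> \<Longrightarrow> \<epsilon> \<le> 1 \<Longrightarrow> coeff (a \<epsilon>) 0 = \<epsilon> * u"
    and coeff1: "\<And>\<epsilon>. 0 < \<epsilon> \<Longrightarrow> \<epsilon> \<le> 1 \<Longrightarrow> coeff (a \<epsilon>) 1 = 1 + \<epsilon> * v"
    and "0 < \<delta>"
  shows False
proof -
  obtain S :: "real set" where S: "finite S" "card S = Suc n" "S \<subseteq> {0..1}"
    using infinite_arbitrarily_large[of "{0..1::real}" "Suc n"] by auto
  from coeff_bound_by_values[OF S(1)] obtain K where K:
    "\<forall>p M. (p = 0 \<or> degree p < card S) \<longrightarrow> 0 \<le> M \<longrightarrow>
      (\<forall>x\<in>S. \<bar>poly p x\<bar> \<le> M) \<longrightarrow> (\<forall>i. \<bar>coeff p i\<bar> \<le> K * M)" ..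
  have "0 \<le> M" using bound[of 1 0] by auto
  define C where "C = (real n + 1) * (K * M)"
  have coeffs: "\<bar>coeff (a \<epsilon>) i\<bar> \<le> K * M" if "0 < \<epsilon>" "\<epsilon> \<le> 1" for \<epsilon> i
  proof (rule K[rule_format])
    show "a \<epsilon> = 0 \<or> degree (a \<epsilon>) < card S"
      using deg[OF that] S(2) by simp
    show "\<bar>poly (a \<epsilon>) x\<bar> \<le> M" if "x \<in> S" for x
      using bound[OF \<open>0 < \<epsilon>\<close> \<open>\<epsilon> \<le> 1\<close>] S(3) that by auto
  qed fact
  have "0 \<le> C"
  proof -
    have "0 \<le> K * M" using coeffs[of 1 0] by simp
    then show ?thesis by (simp add: C_def)
  qed
  \<comment> \<open>The bound \<open>s \<le> 1 / (2 (C + 1))\<close> makes the quadratic error \<open>C s\<^sup>2\<close> at most \<open>s / 2\<close>.\<close>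
  define s where "s = min \<delta> (1 / (2 * (C + 1)))"
  have s: "0 < s" "s \<le> \<delta>" "s \<le> 1" "s \<le> 1 / (2 * (C + 1))"
    using \<open>0 < \<delta>\<close> \<open>0 \<le> C\<close> by (auto simp: s_def min_le_iff_disj)
  have "C * s \<le> (C + 1) * s" using s by simp
  also have "\<dots> \<le> 1 / 2" using s \<open>0 \<le> C\<close> by (simp add: field_simps)
  finally have "(C * s) * s \<le> 1 / 2 * s"
    using s by (intro mult_right_mono) auto
  then have Cs: "C * s\<^sup>2 \<le> s / 2" by (simp add: power2_eq_square mult_ac)
  \<comment> \<open>For this \<open>\<epsilon>\<close> the perturbation \<open>\<epsilon> (u - s v)\<close> is smaller than the remaining \<open>s / 2\<close>.\<close>
  define \<epsilon> where "\<epsilon> = min 1 (s / (4 * (\<bar>u\<bar> + \<bar>v\<bar> + 1)))"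
  have \<epsilon>: "0 < \<epsilon>" "\<epsilon> \<le> 1" "\<epsilon> \<le> s / (4 * (\<bar>u\<bar> + \<bar>v\<bar> + 1))"
    using s by (auto simp: \<epsilon>_def)
  have "u - s * v \<le> \<bar>u\<bar> + \<bar>v\<bar> + 1"
  proof -
    have "\<bar>s * v\<bar> \<le> \<bar>v\<bar>" using s by (simp add: abs_mult mult_left_le_one_le)
    then show ?thesis by linarith
  qed
  then have "\<epsilon> * (u - s * v) \<le> \<epsilon> * (\<bar>u\<bar> + \<bar>v\<bar> + 1)"
    using \<epsilon> by (intro mult_left_mono) auto
  also have "\<dots> \<le> s / 4"
    using \<epsilon>(3) by (simp add: field_simps)
  finally have pert: "\<epsilon> * (u - s * v) \<le> s / 4" .
  have "0 \<le> poly (a \<epsilon>) (- s)"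
    using nonneg[OF \<epsilon>(1,2)] s by simp
  also have "\<dots> \<le> coeff (a \<epsilon>) 0 + coeff (a \<epsilon>) 1 * (- s) + (real n + 1) * (K * M) * (- s)\<^sup>2"
    using deg coeffs \<epsilon> s by (intro quadratic_taylor_bound) auto
  also have "\<dots> = \<epsilon> * (u - s * v) - s + C * s\<^sup>2"
    unfolding coeff0[OF \<epsilon>(1,2)] coeff1[OF \<epsilon>(1,2)] by (simp add: C_def algebra_simps)
  also have "\<dots> < 0" using pert Cs s by linarith
  finally show False by simp
qed

theorem corollary3p3:
  fixes f1 f2 f3 f4 :: poly_XY
  assumes "f1 = var_Y ^ 3"
    and "f2 = var_Y + var_X"
    and "f3 = 1 - var_X * var_Y"
    and "f4 = 1 - var_X ^ 2"
  shows "\<not> ddagger_property [f1, f2, f3, f4]"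
proof
  assume dd: "ddagger_property [f1, f2, f3, f4]"
  have "var_Y \<in> Pos (nonneg_set [f1, f2, f3, f4])"
    using assms by (auto simp: Pos_def nonneg_set_def zero_le_power_eq)
  then obtain q where q: "\<And>\<epsilon>. \<epsilon> > 0 \<Longrightarrow> var_Y + [:[:\<epsilon>:]:] * q \<in> PO [f1, f2, f3, f4]"
    using dd by (auto simp: ddagger_property_def ddagger_def)
  define p where "p = (\<lambda>\<epsilon>. var_Y + [:[:\<epsilon>:]:] * q)"
  have "\<exists>A B. p \<epsilon> = A + f1 * B \<and> (\<forall>z\<in>nonneg_set [f2, f3, f4]. eval_XY A z \<ge> 0)
      \<and> (\<forall>z\<in>nonneg_set [f2, f3, f4]. eval_XY B z \<ge> 0)" if "\<epsilon> > 0" for \<epsilon>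
    using PO_Cons_decompose[OF q[OF that]] unfolding p_def by metis
  then obtain A B where AB: "\<And>\<epsilon>. \<epsilon> > 0 \<Longrightarrow> p \<epsilon> = A \<epsilon> + f1 * B \<epsilon>"
    and A: "\<And>\<epsilon> z. \<epsilon> > 0 \<Longrightarrow> z \<in> nonneg_set [f2, f3, f4] \<Longrightarrow> eval_XY (A \<epsilon>) z \<ge> 0"
    and B: "\<And>\<epsilon> z. \<epsilon> > 0 \<Longrightarrow> z \<in> nonneg_set [f2, f3, f4] \<Longrightarrow> eval_XY (B \<epsilon>) z \<ge> 0"
    by metis
  have A_le: "eval_XY (A \<epsilon>) (x, y) \<le> eval_XY (p \<epsilon>) (x, y)"
    if "\<epsilon> > 0" "(x, y) \<in> nonneg_set [f2, f3, f4]" "y \<ge> 0" for \<epsilon> x y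
    using that AB B assms(1) by simp
  have neg: "(x, y) \<in> nonneg_set [f2, f3, f4]" if "x \<in> {-1<..<0}" "y \<ge> 1" for x y
  proof -
    have "x * y \<le> 0" using that by (simp add: mult_nonpos_nonneg)
    moreover have "x\<^sup>2 \<le> 1" using that by (simp add: abs_square_le_1)
    ultimately show ?thesis using that assms by (simp add: nonneg_set_def)
  qed
  \<comment> \<open>Any abscissa strictly between \<open>0\<close> and \<open>1\<close> would do: \<open>Y + X\<close> stays nonnegative below the axis.\<close>
  have half: "(1/2, y) \<in> nonneg_set [f2, f3, f4]" if "- (1/2) \<le> y" "y \<le> 1" for y
    using that assms by (simp add: nonneg_set_def power2_eq_square)
  define n where "n = max 1 (degree q)"
  have deg_p: "degree (p \<epsilon>) \<le> n" for \<epsilon>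
  proof -
    have "degree var_Y \<le> n" by (simp add: var_Y_def n_def)
    moreover have "degree ([:[:\<epsilon>:]:] * q) \<le> n"
      using degree_smult_le[of "[:\<epsilon>:]" q] by (simp add: n_def)
    ultimately show ?thesis unfolding p_def by (rule degree_add_le)
  qed
  have deg_A: "degree (A \<epsilon>) \<le> n" if "\<epsilon> > 0" for \<epsilon>
  proof -
    have "infinite {-1<..<0::real}" by simp
    then have "degree (A \<epsilon>) \<le> degree (p \<epsilon>)"
      by (rule degree_le_of_half_lines[where c = 1]) (use A A_le neg that in auto)
    then show ?thesis using deg_p[of \<epsilon>] by linarith
  qed
  have "var_Y ^ 3 = (monom 1 3 :: poly_XY)"
    by (simp add: var_Y_def monom_altdef)
  then have low: "coeff (A \<epsilon>) k = coeff (p \<epsilon>) k" if "\<epsilon> > 0" "k < 3" for \<epsilon> k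
    using that by (simp add: AB assms(1) coeff_monom_mult)
  define Q where "Q = (\<Sum>i\<le>n. \<bar>coeff (restrict_X (1/2) q) i\<bar>)"
  show False
  proof (rule no_uniformly_bounded_perturbation)
    fix \<epsilon> :: real assume \<epsilon>: "0 < \<epsilon>" "\<epsilon> \<le> 1"
    show "degree (restrict_X (1/2) (A \<epsilon>)) \<le> n"
      using deg_A[OF \<epsilon>(1)] degree_restrict_X_le[of "1/2" "A \<epsilon>"] by linarith
    show "coeff (restrict_X (1/2) (A \<epsilon>)) 0 = \<epsilon> * poly (coeff q 0) (1/2)"
      using \<epsilon> by (simp add: low p_def var_Y_def)
    show "coeff (restrict_X (1/2) (A \<epsilon>)) 1 = 1 + \<epsilon> * poly (coeff q 1) (1/2)"
      using \<epsilon> by (simp add: low p_def var_Y_def)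
    show "0 \<le> poly (restrict_X (1/2) (A \<epsilon>)) y" if "- (1/2) \<le> y" "y \<le> 0" for y
      using that \<epsilon> A half by (simp add: poly_restrict_X)
    show "\<bar>poly (restrict_X (1/2) (A \<epsilon>)) y\<bar> \<le> 1 + Q" if y: "0 \<le> y" "y \<le> 1" for y
    proof -
      have mem: "(1/2, y) \<in> nonneg_set [f2, f3, f4]" using y by (intro half) auto
      have "degree (restrict_X (1/2) q) \<le> n"
        using degree_restrict_X_le[of "1/2" q] by (simp add: n_def)
      then have "\<bar>poly (restrict_X (1/2) q) y\<bar> \<le> Q"
        unfolding Q_def using y by (intro abs_poly_le_sum_abs_coeff) auto
      then have Q: "\<bar>eval_XY q (1/2, y)\<bar> \<le> Q"
        by (simp add: poly_restrict_X)
      have "\<bar>\<epsilon> * eval_XY q (1/2, y)\<bar> \<le> \<bar>eval_XY q (1/2, y)\<bar>"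
        using \<epsilon> by (simp add: abs_mult mult_left_le_one_le)
      then have "\<epsilon> * eval_XY q (1/2, y) \<le> Q"
        using Q by linarith
      then have "eval_XY (p \<epsilon>) (1/2, y) \<le> 1 + Q"
        using y unfolding p_def by (simp only: eval_XY_simps snd_conv)
      then show ?thesis
        using A_le[OF \<epsilon>(1) mem y(1)] A[OF \<epsilon>(1) mem] by (simp add: poly_restrict_X)
    qed
  qed simp
qed

end
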